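(* Let $X:=\mathcal{K}(2^\omega)\setminus\{\emptyset\}$, $Y:=2^\omega$, and $A:=\{(K,x)\in X\times Y: x\in K\}$. Then $A$ is closed in $X\times Y$, all horizontal sections $\{K\in X: x\in K\}$ ($x\in Y$) are uncountable, the vertical sections $A_K=K$ are uncountable for all $K$ in a comeager subset of $X$, but if $F$ is a comeager Borel subset of $X$ and $G$ a comeager Borel subset of $Y$, there is no Borel isomorphism from $F$ onto $G$ whose graph is contained in $A$.
   Context: $\mathcal{K}(2^\omega)$ is the space of compact subsets of the Cantor space $2^\omega$ with the Vietoris (Hausdorff metric) topology. *)

theory Defs
  imports "HOL-Analysis.Analysis"
begin

(* On the type nat => bool, euclidean is the product topology of the discrete
   topologies on bool; see the lemma cantor_space_eq below. *)
abbreviation cantor_space :: "(nat \<Rightarrow> bool) topology" where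
  "cantor_space \<equiv> euclidean"

lemma cantor_space_eq:
  "cantor_space = product_topology (\<lambda>_. discrete_topology UNIV) UNIV"
proof -
  have "discrete_topology UNIV = (euclidean :: bool topology)"
    by (simp add: topology_eq open_discrete)
  then show ?thesis
    by (simp add: euclidean_product_topology)
qed

(* The space of all compact subsets of T, the empty set included. *)
definition vietoris :: "'a topology \<Rightarrow> 'a set topology" where
  "vietoris T = topology_generated_by
     ({{K. compactin T K \<and> K \<subseteq> U} | U. openin T U} \<union>
      {{K. compactin T K \<and> K \<inter> U \<noteq> {}} | U. openin T U})"

lemma topspace_vietoris [simp]: "topspace (vietoris T) = {K. compactin T K}"
proof
  show "topspace (vietoris T) \<subseteq> {K. compactin T K}"
    unfolding vietoris_def topology_generated_by_topspace by (rule Union_least) auto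
  have "{K. compactin T K} = {K. compactin T K \<and> K \<subseteq> topspace T}"
    using compactin_subset_topspace by (intro Collect_cong) blast
  then show "{K. compactin T K} \<subseteq> topspace (vietoris T)"
    unfolding vietoris_def topology_generated_by_topspace
    by (intro Union_upper UnI1 CollectI exI[of _ "topspace T"]) simp
qed

definition nowhere_dense_in :: "'a topology \<Rightarrow> 'a set \<Rightarrow> bool" where
  "nowhere_dense_in T S \<longleftrightarrow> S \<subseteq> topspace T \<and> T interior_of (T closure_of S) = {}"

definition meager_in :: "'a topology \<Rightarrow> 'a set \<Rightarrow> bool" where
  "meager_in T S \<longleftrightarrow> (\<exists>N :: nat \<Rightarrow> 'a set. (\<forall>n. nowhere_dense_in T (N n)) \<and> S = (\<Union>n. N n))"

definition comeager_in :: "'a topology \<Rightarrow> 'a set \<Rightarrow> bool" where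
  "comeager_in T S \<longleftrightarrow> S \<subseteq> topspace T \<and> meager_in T (topspace T - S)"

definition borel_of :: "'a topology \<Rightarrow> 'a measure" where
  "borel_of T = sigma (topspace T) {U. openin T U}"

definition borel_isomorphism :: "'a topology \<Rightarrow> 'b topology \<Rightarrow> ('a \<Rightarrow> 'b) \<Rightarrow> bool" where
  "borel_isomorphism S T f \<longleftrightarrow>
     bij_betw f (topspace S) (topspace T) \<and>
     f \<in> measurable (borel_of S) (borel_of T) \<and>
     the_inv_into (topspace S) f \<in> measurable (borel_of T) (borel_of S)"

end

theory Submission
  imports Defs
begin

text \<open>
  A meager set \<open>M \<subseteq> Y\<close> is missed by the generic compact set \<open>K\<close>.
  Suppose \<open>f : F \<rightarrow> G\<close> is a Borel isomorphism with \<open>f K \<in> K\<close> and inverse \<open>g\<close>, and for an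
  open \<open>V\<close> let \<open>B\<^sub>V = {x \<in> G. x \<notin> V \<and> g x \<inter> V \<noteq> {}}\<close>, which has the Baire property. If \<open>B\<^sub>V\<close> were not
  meager, it would be comeager in a nonempty open \<open>W\<close>, and a generic \<open>K \<subseteq> W\<close> would be contained
  in \<open>B\<^sub>V\<close>, hence disjoint from \<open>V\<close>; but \<open>f K \<in> B\<^sub>V\<close> says that \<open>K\<close> meets \<open>V\<close>. So every \<open>B\<^sub>V\<close> is
  meager, and a generic \<open>K\<close> misses \<open>B\<^sub>V\<close> for all \<open>V\<close> in a countable base. This is absurd: a
  generic \<open>K\<close> is not the singleton \<open>{f K}\<close>, so some basic \<open>V\<close> meets \<open>K\<close> and avoids \<open>f K\<close>.
\<close>

section \<open>Meager sets and the Baire category theorem\<close>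

lemma nowhere_dense_in_iff_open_disjoint:
  "nowhere_dense_in T S \<longleftrightarrow> S \<subseteq> topspace T \<and>
     (\<forall>U. openin T U \<and> U \<noteq> {} \<longrightarrow> (\<exists>W. openin T W \<and> W \<noteq> {} \<and> W \<subseteq> U \<and> W \<inter> S = {}))"
proof (intro iffI conjI allI impI; (elim conjE)?)
  assume S: "nowhere_dense_in T S"
  then show "S \<subseteq> topspace T"
    by (simp add: nowhere_dense_in_def)
  fix U assume U: "openin T U" "U \<noteq> {}"
  show "\<exists>W. openin T W \<and> W \<noteq> {} \<and> W \<subseteq> U \<and> W \<inter> S = {}"
  proof (intro exI conjI)
    show "openin T (U - T closure_of S)"
      using U(1) by (simp add: openin_diff)
    show "U - T closure_of S \<noteq> {}"
      using S U interior_of_maximal[of U "T closure_of S" T] unfolding nowhere_dense_in_def by blast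
    show "(U - T closure_of S) \<inter> S = {}"
      using \<open>S \<subseteq> topspace T\<close> closure_of_subset by fastforce
  qed blast
next
  assume "S \<subseteq> topspace T"
    and disjoint: "\<forall>U. openin T U \<and> U \<noteq> {} \<longrightarrow> (\<exists>W. openin T W \<and> W \<noteq> {} \<and> W \<subseteq> U \<and> W \<inter> S = {})"
  moreover have "T interior_of (T closure_of S) = {}"
  proof (rule ccontr)
    assume "T interior_of (T closure_of S) \<noteq> {}"
    then obtain W where W: "openin T W" "W \<noteq> {}" "W \<subseteq> T interior_of (T closure_of S)" "W \<inter> S = {}"
      using disjoint openin_interior_of by metis
    then have "W \<inter> T closure_of S = {}"
      by (simp add: openin_Int_closure_of_eq_empty)
    then show False
      using W(2,3) interior_of_subset[of T "T closure_of S"] by blast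
  qed
  ultimately show "nowhere_dense_in T S"
    by (simp add: nowhere_dense_in_def)
qed

lemma nowhere_dense_in_subset:
  assumes "nowhere_dense_in T S" "R \<subseteq> S"
  shows "nowhere_dense_in T R"
  using assms unfolding nowhere_dense_in_iff_open_disjoint by (meson disjoint_iff subset_iff)

lemma nowhere_dense_in_frontier_of_openin:
  assumes "openin T U"
  shows "nowhere_dense_in T (T frontier_of U)"
  unfolding nowhere_dense_in_iff_open_disjoint
proof (intro conjI allI impI; (elim conjE)?)
  show "T frontier_of U \<subseteq> topspace T"
    by (rule frontier_of_subset_topspace)
  fix V assume V: "openin T V" "V \<noteq> {}"
  show "\<exists>W. openin T W \<and> W \<noteq> {} \<and> W \<subseteq> V \<and> W \<inter> T frontier_of U = {}"
  proof (cases "V \<inter> U = {}")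
    case True
    then have "V \<inter> T closure_of U = {}"
      by (simp add: V(1) openin_Int_closure_of_eq_empty)
    then show ?thesis
      using V by (auto simp: frontier_of_def)
  next
    case False
    then show ?thesis
      using V(1) assms by (intro exI[of _ "V \<inter> U"]) (auto simp: frontier_of_openin)
  qed
qed

lemma meager_in_iff_countable_cover:
  "meager_in T S \<longleftrightarrow> (\<exists>\<N>. countable \<N> \<and> (\<forall>N\<in>\<N>. nowhere_dense_in T N) \<and> S \<subseteq> \<Union>\<N>)"
proof
  assume "meager_in T S"
  then obtain N :: "nat \<Rightarrow> _" where "\<And>n. nowhere_dense_in T (N n)" "S = (\<Union>n. N n)"
    unfolding meager_in_def by blast
  then show "\<exists>\<N>. countable \<N> \<and> (\<forall>N\<in>\<N>. nowhere_dense_in T N) \<and> S \<subseteq> \<Union>\<N>"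
    by (intro exI[of _ "range N"]) auto
next
  assume "\<exists>\<N>. countable \<N> \<and> (\<forall>N\<in>\<N>. nowhere_dense_in T N) \<and> S \<subseteq> \<Union>\<N>"
  then obtain \<N> where \<N>: "countable \<N>" "\<And>N. N \<in> \<N> \<Longrightarrow> nowhere_dense_in T N" "S \<subseteq> \<Union>\<N>"
    by blast
  define N where "N = from_nat_into (insert {} \<N>)"
  have range_N: "range N = insert {} \<N>"
    using \<N>(1) by (simp add: N_def)
  have "nowhere_dense_in T {}"
    by (simp add: nowhere_dense_in_def)
  then have "nowhere_dense_in T (N n)" for n
    using \<N>(2) range_N by (metis insertE rangeI)
  then have "nowhere_dense_in T (N n \<inter> S)" for n
    by (rule nowhere_dense_in_subset) blast
  moreover have "S = (\<Union>n. N n \<inter> S)"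
    using \<N>(3) range_N by auto
  ultimately show "meager_in T S"
    unfolding meager_in_def by (intro exI[of _ "\<lambda>n. N n \<inter> S"]) simp
qed

lemma meager_in_subset: "meager_in T S \<Longrightarrow> R \<subseteq> S \<Longrightarrow> meager_in T R"
  unfolding meager_in_iff_countable_cover by (meson order_trans)

lemma nowhere_dense_imp_meager_in: "nowhere_dense_in T S \<Longrightarrow> meager_in T S"
  unfolding meager_in_iff_countable_cover by (intro exI[of _ "{S}"]) simp

lemma meager_in_empty [simp]: "meager_in T {}"
  unfolding meager_in_iff_countable_cover by (intro exI[of _ "{}"]) simp

lemma meager_in_UN:
  assumes "countable I" "\<And>i. i \<in> I \<Longrightarrow> meager_in T (S i)"
  shows "meager_in T (\<Union>i\<in>I. S i)"
proof -
  obtain \<N> where "\<And>i. i \<in> I \<Longrightarrow>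
      countable (\<N> i) \<and> (\<forall>N\<in>\<N> i. nowhere_dense_in T N) \<and> S i \<subseteq> \<Union>(\<N> i)"
    using assms(2) unfolding meager_in_iff_countable_cover by metis
  with assms(1) show ?thesis
    unfolding meager_in_iff_countable_cover by (intro exI[of _ "\<Union>i\<in>I. \<N> i"]) fastforce
qed

lemma meager_in_Un:
  assumes "meager_in T R" "meager_in T S"
  shows "meager_in T (R \<union> S)"
proof -
  have "meager_in T (\<Union>Q\<in>{R, S}. Q)"
    using assms by (intro meager_in_UN) auto
  then show ?thesis
    by simp
qed

lemma comeager_in_Int: "comeager_in T R \<Longrightarrow> comeager_in T S \<Longrightarrow> comeager_in T (R \<inter> S)"
  unfolding comeager_in_def by (auto simp: Diff_Int meager_in_Un)

lemma comeager_in_superset: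
  "comeager_in T R \<Longrightarrow> R \<subseteq> S \<Longrightarrow> S \<subseteq> topspace T \<Longrightarrow> comeager_in T S"
  unfolding comeager_in_def by (meson Diff_mono meager_in_subset order_refl)

lemma comeager_in_meets_open:
  assumes "completely_metrizable_space T \<or> locally_compact_space T \<and> regular_space T"
    and S: "comeager_in T S" and U: "openin T U" "U \<noteq> {}"
  shows "U \<inter> S \<noteq> {}"
proof
  assume "U \<inter> S = {}"
  obtain \<N> where \<N>: "countable \<N>" "\<And>N. N \<in> \<N> \<Longrightarrow> nowhere_dense_in T N" "topspace T - S \<subseteq> \<Union>\<N>"
    using S unfolding comeager_in_def meager_in_iff_countable_cover by blast
  have empty_interior: "T interior_of \<Union>((closure_of) T ` \<N>) = {}"
    using \<N>(1,2) by (intro Baire_category_alt assms) (auto simp: nowhere_dense_in_def)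
  have "U \<subseteq> \<Union>\<N>"
    using \<open>U \<inter> S = {}\<close> openin_subset[OF U(1)] \<N>(3) by blast
  also have "\<dots> \<subseteq> \<Union>((closure_of) T ` \<N>)"
    using \<N>(2) closure_of_subset unfolding nowhere_dense_in_def by fast
  finally show False
    using U empty_interior interior_of_maximal by blast
qed

section \<open>The Baire property\<close>

definition baire_property_in :: "'a topology \<Rightarrow> 'a set \<Rightarrow> bool" where
  "baire_property_in T S \<longleftrightarrow> S \<subseteq> topspace T \<and> (\<exists>U. openin T U \<and> meager_in T (sym_diff S U))"

lemma baire_property_in_open: "openin T U \<Longrightarrow> baire_property_in T U"
  unfolding baire_property_in_def by (metis Diff_cancel Un_absorb meager_in_empty openin_subset)

lemma baire_property_in_comeager: "comeager_in T S \<Longrightarrow> baire_property_in T S"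
  unfolding baire_property_in_def comeager_in_def
  by (intro conjI exI[of _ "topspace T"]) (auto elim: meager_in_subset)

lemma baire_property_in_compl:
  assumes "baire_property_in T S"
  shows "baire_property_in T (topspace T - S)"
proof -
  obtain U where U: "openin T U" "meager_in T (sym_diff S U)"
    using assms unfolding baire_property_in_def by blast
  have "meager_in T (T frontier_of U)"
    by (intro nowhere_dense_imp_meager_in nowhere_dense_in_frontier_of_openin U(1))
  then have "meager_in T (sym_diff S U \<union> T frontier_of U)"
    by (intro meager_in_Un U(2))
  moreover have "sym_diff (topspace T - S) (topspace T - T closure_of U)
      \<subseteq> sym_diff S U \<union> T frontier_of U"
    using closure_of_subset[OF openin_subset[OF U(1)]] by (auto simp: frontier_of_openin U(1))
  ultimately have "meager_in T (sym_diff (topspace T - S) (topspace T - T closure_of U))"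
    by (rule meager_in_subset)
  then show ?thesis
    unfolding baire_property_in_def by (intro conjI exI[of _ "topspace T - T closure_of U"]) auto
qed

lemma baire_property_in_UN:
  assumes "countable I" "\<And>i. i \<in> I \<Longrightarrow> baire_property_in T (S i)"
  shows "baire_property_in T (\<Union>i\<in>I. S i)"
proof -
  obtain U where U: "\<And>i. i \<in> I \<Longrightarrow> openin T (U i)" "\<And>i. i \<in> I \<Longrightarrow> meager_in T (sym_diff (S i) (U i))"
    using assms(2) unfolding baire_property_in_def by metis
  have "meager_in T (\<Union>i\<in>I. sym_diff (S i) (U i))"
    by (intro meager_in_UN assms(1) U(2))
  then have "meager_in T (sym_diff (\<Union>i\<in>I. S i) (\<Union>i\<in>I. U i))"
    by (rule meager_in_subset) blast
  moreover have "openin T (\<Union>i\<in>I. U i)"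
    using U(1) by blast
  moreover have "(\<Union>i\<in>I. S i) \<subseteq> topspace T"
    using assms(2) unfolding baire_property_in_def by blast
  ultimately show ?thesis
    unfolding baire_property_in_def by blast
qed

lemma sigma_algebra_baire_property_in: "sigma_algebra (topspace T) {S. baire_property_in T S}"
  unfolding sigma_algebra_iff2
proof (intro conjI ballI allI impI)
  show "{S. baire_property_in T S} \<subseteq> Pow (topspace T)"
    by (auto simp: baire_property_in_def)
qed (auto intro: baire_property_in_open baire_property_in_compl baire_property_in_UN)

lemma baire_property_in_diff:
  assumes "baire_property_in T R" "baire_property_in T S"
  shows "baire_property_in T (R - S)"
proof -
  interpret sigma_algebra "topspace T" "{S. baire_property_in T S}"
    by (rule sigma_algebra_baire_property_in)
  show ?thesis
    using Diff assms by blast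
qed

lemma space_borel_of [simp]: "space (borel_of T) = topspace T"
  by (simp add: borel_of_def space_measure_of_conv)

lemma sets_borel_of: "sets (borel_of T) = sigma_sets (topspace T) {U. openin T U}"
  unfolding borel_of_def by (intro sets_measure_of) (auto dest: openin_subset)

lemma baire_property_in_borel_of_subtopology:
  assumes "baire_property_in T G" "S \<in> sets (borel_of (subtopology T G))"
  shows "baire_property_in T S"
proof -
  have "{U. openin (subtopology T G) U} \<subseteq> (\<inter>) G ` {S. baire_property_in T S}"
    unfolding openin_subtopology_alt Collect_mem_eq
    by (intro image_mono) (auto intro: baire_property_in_open)
  moreover have "sigma_algebra G ((\<inter>) G ` {S. baire_property_in T S})"
    using sigma_algebra.restricted_sigma_algebra[OF sigma_algebra_baire_property_in] assms(1) by blast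
  ultimately have "sigma_sets G {U. openin (subtopology T G) U} \<subseteq> (\<inter>) G ` {S. baire_property_in T S}"
    by (intro sigma_algebra.sigma_sets_subset)
  moreover have "topspace (subtopology T G) = G"
    using assms(1) by (auto simp: baire_property_in_def)
  ultimately obtain R where "S = G \<inter> R" "baire_property_in T R"
    using assms(2) unfolding sets_borel_of by auto
  then have "S = G - (G - R)" "baire_property_in T (G - (G - R))"
    using assms(1) by (auto intro: baire_property_in_diff)
  then show ?thesis
    by simp
qed

lemma baire_property_in_borel_vimage_open:
  assumes "baire_property_in T G"
    and "g \<in> measurable (borel_of (subtopology T G)) (borel_of Z)" "openin Z V"
  shows "baire_property_in T {x \<in> G. g x \<in> V}"
proof -
  have "V \<in> sets (borel_of Z)"
    using assms(3) by (simp add: sets_borel_of)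
  then have "g -` V \<inter> topspace (subtopology T G) \<in> sets (borel_of (subtopology T G))"
    using measurable_sets[OF assms(2)] by simp
  moreover have "g -` V \<inter> topspace (subtopology T G) = {x \<in> G. g x \<in> V}"
    using assms(1) by (auto simp: baire_property_in_def)
  ultimately show ?thesis
    using assms(1) baire_property_in_borel_of_subtopology by metis
qed

section \<open>The Vietoris topology\<close>

definition compacts_within :: "'a topology \<Rightarrow> 'a set \<Rightarrow> 'a set set" where
  "compacts_within T U = {K. compactin T K \<and> K \<subseteq> U}"

definition compacts_meeting :: "'a topology \<Rightarrow> 'a set \<Rightarrow> 'a set set" where
  "compacts_meeting T U = {K. compactin T K \<and> K \<inter> U \<noteq> {}}"

definition vietoris_basic :: "'a topology \<Rightarrow> 'a set \<Rightarrow> 'a set set \<Rightarrow> 'a set set" where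
  "vietoris_basic T U \<V> = {K \<in> compacts_within T U. \<forall>V\<in>\<V>. K \<inter> V \<noteq> {}}"

lemma vietoris_eq_generated:
  "vietoris T = topology_generated_by
     (compacts_within T ` {U. openin T U} \<union> compacts_meeting T ` {U. openin T U})"
  by (simp only: vietoris_def setcompr_eq_image
      compacts_within_def[abs_def] compacts_meeting_def[abs_def])

lemma openin_vietoris_within: "openin T U \<Longrightarrow> openin (vietoris T) (compacts_within T U)"
  unfolding vietoris_eq_generated by (intro topology_generated_by_Basis) simp

lemma openin_vietoris_meeting: "openin T U \<Longrightarrow> openin (vietoris T) (compacts_meeting T U)"
  unfolding vietoris_eq_generated by (intro topology_generated_by_Basis) simp

lemma openin_vietoris_basic:
  assumes "openin T U" "finite \<V>" "\<And>V. V \<in> \<V> \<Longrightarrow> openin T V"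
  shows "openin (vietoris T) (vietoris_basic T U \<V>)"
proof -
  have "openin (vietoris T) (\<Inter>(insert (compacts_within T U) (compacts_meeting T ` \<V>)))"
    using assms by (intro openin_Inter) (auto intro: openin_vietoris_within openin_vietoris_meeting)
  moreover have "\<Inter>(insert (compacts_within T U) (compacts_meeting T ` \<V>)) = vietoris_basic T U \<V>"
    by (auto simp: vietoris_basic_def compacts_within_def compacts_meeting_def)
  ultimately show ?thesis
    by simp
qed

lemma vietoris_basic_Int:
  "vietoris_basic T U \<V> \<inter> vietoris_basic T U' \<V>' = vietoris_basic T (U \<inter> U') (\<V> \<union> \<V>')"
  by (auto simp: vietoris_basic_def compacts_within_def)

lemma topology_generated_by_neighbourhood:
  assumes "\<B> \<subseteq> \<E>" "\<And>D E. D \<in> \<E> \<Longrightarrow> E \<in> \<E> \<Longrightarrow> D \<inter> E \<in> \<E>"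
    and "openin (topology_generated_by \<B>) S" "x \<in> S"
  shows "\<exists>E\<in>\<E>. x \<in> E \<and> E \<subseteq> S"
  using openin_topology_generated_by[OF assms(3)] assms(4)
proof induction
  case Empty
  then show ?case by simp
next
  case (Int P Q)
  then obtain D E where "D \<in> \<E>" "x \<in> D" "D \<subseteq> P" "E \<in> \<E>" "x \<in> E" "E \<subseteq> Q"
    by blast
  then show ?case
    using assms(2) by (intro bexI[of _ "D \<inter> E"]) auto
next
  case (UN \<K>)
  then show ?case
    by (meson UnionE Union_upper order_trans)
next
  case (Basis B)
  then show ?case
    using assms(1) by blast
qed

lemma vietoris_basic_neighbourhood:
  assumes "openin (vietoris T) \<U>" "K \<in> \<U>"
  obtains U \<V> where "openin T U" "finite \<V>" "\<forall>V\<in>\<V>. openin T V"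
    "K \<in> vietoris_basic T U \<V>" "vietoris_basic T U \<V> \<subseteq> \<U>"
proof -
  let ?\<E> = "{vietoris_basic T U \<V> | U \<V>. openin T U \<and> finite \<V> \<and> (\<forall>V\<in>\<V>. openin T V)}"
  have within: "compacts_within T U = vietoris_basic T U {}" for U
    by (simp add: vietoris_basic_def)
  have meeting: "compacts_meeting T V = vietoris_basic T (topspace T) {V}" for V
    using compactin_subset_topspace
    by (fastforce simp: vietoris_basic_def compacts_within_def compacts_meeting_def)
  have "compacts_within T U \<in> ?\<E>" "compacts_meeting T U \<in> ?\<E>" if "openin T U" for U
    unfolding within meeting using that by blast+
  then have "compacts_within T ` {U. openin T U} \<union> compacts_meeting T ` {U. openin T U} \<subseteq> ?\<E>"
    by blast
  moreover have "\<D> \<inter> \<E> \<in> ?\<E>" if basic: "\<D> \<in> ?\<E>" "\<E> \<in> ?\<E>" for \<D> \<E>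
  proof -
    obtain U \<V> U' \<V>' where "\<D> = vietoris_basic T U \<V>" "\<E> = vietoris_basic T U' \<V>'"
      "openin T U \<and> finite \<V> \<and> (\<forall>V\<in>\<V>. openin T V)" "openin T U' \<and> finite \<V>' \<and> (\<forall>V\<in>\<V>'. openin T V)"
      using basic by blast
    then show ?thesis
      by (intro CollectI exI[of _ "U \<inter> U'"] exI[of _ "\<V> \<union> \<V>'"]) (auto simp: vietoris_basic_Int)
  qed
  ultimately have "\<exists>\<E>\<in>?\<E>. K \<in> \<E> \<and> \<E> \<subseteq> \<U>"
    by (rule topology_generated_by_neighbourhood) (use assms in \<open>simp_all add: vietoris_eq_generated\<close>)
  then show thesis
    using that by blast
qed

lemma vietoris_basic_nonempty:
  assumes "openin T U" "finite \<V>" "\<And>V. V \<in> \<V> \<Longrightarrow> U \<inter> V \<noteq> {}"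
  shows "vietoris_basic T U \<V> \<noteq> {}"
proof -
  have "\<forall>V\<in>\<V>. \<exists>x. x \<in> U \<inter> V"
    using assms(3) by blast
  then obtain y where y: "\<And>V. V \<in> \<V> \<Longrightarrow> y V \<in> U \<inter> V"
    by metis
  then have "compactin T (y ` \<V>)"
    using assms(1,2) by (intro finite_imp_compactin) (auto dest: openin_subset)
  then have "y ` \<V> \<in> vietoris_basic T U \<V>"
    using y by (auto simp: vietoris_basic_def compacts_within_def)
  then show ?thesis
    by blast
qed

lemma topology_generated_by_eq_subbase:
  "topology_generated_by \<B> =
     topology (arbitrary union_of (finite intersection_of (\<lambda>S. S \<in> \<B>) relative_to \<Union>\<B>))"
  (is "?generated = ?subbase")
  unfolding topology_eq
proof (intro allI iffI)
  fix S assume "openin ?generated S"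
  then have "generate_topology_on \<B> S"
    by (rule openin_topology_generated_by)
  moreover have "openin ?subbase B" if "B \<in> \<B>" for B
  proof -
    have "(finite intersection_of (\<lambda>S. S \<in> \<B>) relative_to \<Union>\<B>) (\<Union>\<B> \<inter> B)"
      using that by (intro relative_to_inc finite_intersection_of_inc)
    moreover have "\<Union>\<B> \<inter> B = B"
      using that by blast
    ultimately show ?thesis
      unfolding openin_subbase by (intro arbitrary_union_of_inc) simp
  qed
  ultimately show "openin ?subbase S"
    using generate_topology_on_coarsest[of "openin ?subbase" \<B> S] by simp
next
  fix S assume "openin ?subbase S"
  then show "openin ?generated S"
    by (rule minimal_topology_subbase[rotated 2])
      (use openin_topspace[of ?generated] in \<open>auto intro: topology_generated_by_Basis\<close>)
qed

lemma compact_space_topology_generated_by: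
  assumes "\<And>\<C>. \<C> \<subseteq> \<B> \<Longrightarrow> \<Union>\<C> = \<Union>\<B> \<Longrightarrow> \<exists>\<C>'. finite \<C>' \<and> \<C>' \<subseteq> \<C> \<and> \<Union>\<C>' = \<Union>\<B>"
  shows "compact_space (topology_generated_by \<B>)"
  by (rule Alexander_subbase[OF topology_generated_by_eq_subbase[symmetric]]) (simp add: assms)

lemma compacts_cover_imp_finite_subcover:
  assumes "compact_space T" "\<And>U. U \<in> \<S> \<Longrightarrow> openin T U" "\<And>V. V \<in> \<M> \<Longrightarrow> openin T V"
    and cover: "\<And>K. compactin T K \<Longrightarrow> (\<exists>U\<in>\<S>. K \<subseteq> U) \<or> (\<exists>V\<in>\<M>. K \<inter> V \<noteq> {})"
  obtains U \<F> where "U \<in> \<S>" "finite \<F>" "\<F> \<subseteq> \<M>" "topspace T \<subseteq> U \<union> \<Union>\<F>"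
proof -
  \<comment> \<open>The largest compact set that meets no member of \<open>\<M>\<close>.\<close>
  define K where "K = topspace T - \<Union>\<M>"
  have "closedin T K"
    unfolding K_def using assms(3) by (intro closedin_diff closedin_topspace openin_Union)
  then have "compactin T K"
    using assms(1) by (simp add: closedin_compact_space)
  then obtain U where U: "U \<in> \<S>" "K \<subseteq> U"
    using cover[of K] by (auto simp: K_def)
  have "compactin T (topspace T - U)"
    using assms(1) assms(2)[OF U(1)] by (simp add: closedin_compact_space closedin_diff)
  moreover have "topspace T - U \<subseteq> \<Union>\<M>"
    using U(2) by (auto simp: K_def)
  ultimately obtain \<F> where "finite \<F>" "\<F> \<subseteq> \<M>" "topspace T - U \<subseteq> \<Union>\<F>"
    using compactinD[of T "topspace T - U" \<M>] assms(3) by metis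
  then show thesis
    using U(1) by (intro that[of U \<F>]) auto
qed

lemma compact_space_vietoris:
  assumes "compact_space T"
  shows "compact_space (vietoris T)"
  unfolding vietoris_eq_generated
proof (rule compact_space_topology_generated_by)
  let ?\<B> = "compacts_within T ` {U. openin T U} \<union> compacts_meeting T ` {U. openin T U}"
  have Union_\<B>: "\<Union>?\<B> = {K. compactin T K}"
    using topspace_vietoris[of T] unfolding vietoris_eq_generated by simp
  fix \<C> assume \<C>: "\<C> \<subseteq> ?\<B>" "\<Union>\<C> = \<Union>?\<B>"
  define \<S> where "\<S> = {U. openin T U \<and> compacts_within T U \<in> \<C>}"
  define \<M> where "\<M> = {V. openin T V \<and> compacts_meeting T V \<in> \<C>}"
  have opens: "\<And>U. U \<in> \<S> \<Longrightarrow> openin T U" "\<And>V. V \<in> \<M> \<Longrightarrow> openin T V"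
    by (simp_all add: \<S>_def \<M>_def)
  have cover: "(\<exists>U\<in>\<S>. K \<subseteq> U) \<or> (\<exists>V\<in>\<M>. K \<inter> V \<noteq> {})" if "compactin T K" for K
  proof -
    have "K \<in> \<Union>\<C>"
      using that \<C>(2) Union_\<B> by simp
    then obtain \<A> where \<A>: "\<A> \<in> \<C>" "K \<in> \<A>"
      by blast
    then consider U where "openin T U" "\<A> = compacts_within T U"
      | V where "openin T V" "\<A> = compacts_meeting T V"
      using \<C>(1) by blast
    then show ?thesis
      using \<A> unfolding \<S>_def \<M>_def by cases (auto simp: compacts_within_def compacts_meeting_def)
  qed
  obtain U \<F> where U: "U \<in> \<S>" and \<F>: "finite \<F>" "\<F> \<subseteq> \<M>" "topspace T \<subseteq> U \<union> \<Union>\<F>"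
    by (rule compacts_cover_imp_finite_subcover[OF assms opens cover])
  show "\<exists>\<C>'. finite \<C>' \<and> \<C>' \<subseteq> \<C> \<and> \<Union>\<C>' = \<Union>?\<B>"
  proof (intro exI conjI)
    let ?\<C>' = "insert (compacts_within T U) (compacts_meeting T ` \<F>)"
    show "finite ?\<C>'" "?\<C>' \<subseteq> \<C>"
      using U \<F>(1,2) by (auto simp: \<S>_def \<M>_def)
    have "L \<in> \<Union>?\<C>'" if "compactin T L" for L
      using that \<F>(3) compactin_subset_topspace[OF that]
      by (auto simp: compacts_within_def compacts_meeting_def)
    then show "\<Union>?\<C>' = \<Union>?\<B>"
      unfolding Union_\<B> by (auto simp: compacts_within_def compacts_meeting_def)
  qed
qed

lemma Hausdorff_space_separate_point_compact:
  assumes "Hausdorff_space T" "compactin T K" "x \<in> topspace T" "x \<notin> K"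
  obtains U V where "openin T U" "openin T V" "x \<in> U" "K \<subseteq> V" "disjnt U V"
proof -
  have "compactin T {x}" "disjnt {x} K"
    using assms(3,4) by simp_all
  then obtain U V where "openin T U" "openin T V" "{x} \<subseteq> U" "K \<subseteq> V" "disjnt U V"
    using assms(1,2) unfolding Hausdorff_space_compact_sets by metis
  then show thesis
    by (intro that) auto
qed

lemma Hausdorff_space_vietoris:
  assumes "Hausdorff_space T"
  shows "Hausdorff_space (vietoris T)"
proof -
  have separated: "\<exists>\<U> \<V>. openin (vietoris T) \<U> \<and> openin (vietoris T) \<V> \<and> K \<in> \<U> \<and> L \<in> \<V> \<and> disjnt \<U> \<V>"
    if KL: "compactin T K" "compactin T L" and "\<not> K \<subseteq> L" for K L
  proof -
    obtain x where x: "x \<in> K" "x \<notin> L"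
      using \<open>\<not> K \<subseteq> L\<close> by blast
    then obtain U V where UV: "openin T U" "openin T V" "x \<in> U" "L \<subseteq> V" "disjnt U V"
      using Hausdorff_space_separate_point_compact[OF assms KL(2)]
        compactin_subset_topspace[OF KL(1)] by blast
    show ?thesis
    proof (intro exI conjI)
      show "openin (vietoris T) (compacts_meeting T U)" "openin (vietoris T) (compacts_within T V)"
        using UV by (simp_all add: openin_vietoris_meeting openin_vietoris_within)
      show "K \<in> compacts_meeting T U" "L \<in> compacts_within T V"
        "disjnt (compacts_meeting T U) (compacts_within T V)"
        using UV x KL by (auto simp: compacts_meeting_def compacts_within_def disjnt_iff)
    qed
  qed
  show ?thesis
    unfolding Hausdorff_space_def
  proof (intro allI impI)
    fix K L assume KL: "K \<in> topspace (vietoris T) \<and> L \<in> topspace (vietoris T) \<and> K \<noteq> L"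
    then consider "\<not> K \<subseteq> L" | "\<not> L \<subseteq> K" by blast
    then show "\<exists>\<U> \<V>. openin (vietoris T) \<U> \<and> openin (vietoris T) \<V> \<and> K \<in> \<U> \<and> L \<in> \<V> \<and> disjnt \<U> \<V>"
    proof cases
      case 1
      then show ?thesis
        using separated[of K L] KL by simp
    next
      case 2
      then show ?thesis
        using separated[of L K] KL disjnt_sym by (metis mem_Collect_eq topspace_vietoris)
    qed
  qed
qed

lemma closedin_vietoris_membership:
  assumes "Hausdorff_space T"
  shows "closedin (prod_topology (vietoris T) T) {(K, x). compactin T K \<and> x \<in> K}"
    (is "closedin ?P ?A")
proof -
  have "openin ?P (topspace ?P - ?A)"
    unfolding openin_prod_topology_alt
  proof (intro allI impI)
    fix K x assume "(K, x) \<in> topspace ?P - ?A"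
    then have K: "compactin T K" and x: "x \<in> topspace T" "x \<notin> K"
      by auto
    then obtain U V where UV: "openin T U" "openin T V" "x \<in> U" "K \<subseteq> V" "disjnt U V"
      using Hausdorff_space_separate_point_compact[OF assms K x] by blast
    show "\<exists>\<U> W. openin (vietoris T) \<U> \<and> openin T W \<and> K \<in> \<U> \<and> x \<in> W \<and> \<U> \<times> W \<subseteq> topspace ?P - ?A"
    proof (intro exI conjI)
      show "openin (vietoris T) (compacts_within T V)"
        by (rule openin_vietoris_within) fact
      show "K \<in> compacts_within T V" "compacts_within T V \<times> U \<subseteq> topspace ?P - ?A"
        using K UV openin_subset[OF UV(1)] by (auto simp: compacts_within_def disjnt_iff)
    qed fact+
  qed
  moreover have "?A \<subseteq> topspace ?P"
    using compactin_subset_topspace by fastforce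
  ultimately show ?thesis
    unfolding closedin_def by blast
qed

section \<open>The hyperspace of nonempty compact sets\<close>

definition hyperspace :: "'a topology \<Rightarrow> 'a set topology" where
  "hyperspace T = subtopology (vietoris T) (topspace (vietoris T) - {{}})"

lemma topspace_hyperspace [simp]: "topspace (hyperspace T) = {K. compactin T K \<and> K \<noteq> {}}"
  by (auto simp: hyperspace_def)

lemma topspace_hyperspace_nonempty:
  assumes "topspace T \<noteq> {}"
  shows "topspace (hyperspace T) \<noteq> {}"
proof -
  obtain x where "x \<in> topspace T"
    using assms by blast
  then have "{x} \<in> topspace (hyperspace T)"
    by simp
  then show ?thesis
    by blast
qed

lemma openin_hyperspace_iff: "openin (hyperspace T) \<U> \<longleftrightarrow> openin (vietoris T) \<U> \<and> {} \<notin> \<U>"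
proof -
  have "compacts_meeting T (topspace T) = topspace (vietoris T) - {{}}"
    using compactin_subset_topspace by (fastforce simp: compacts_meeting_def)
  then have "openin (vietoris T) (topspace (vietoris T) - {{}})"
    by (metis openin_topspace openin_vietoris_meeting)
  then show ?thesis
    using openin_subset[of "vietoris T" \<U>] by (auto simp: hyperspace_def openin_open_subtopology)
qed

lemma openin_hyperspace_basic:
  assumes "openin T U" "finite \<V>" "\<V> \<noteq> {}" "\<And>V. V \<in> \<V> \<Longrightarrow> openin T V"
  shows "openin (hyperspace T) (vietoris_basic T U \<V>)"
proof -
  have "{} \<notin> vietoris_basic T U \<V>"
    using assms(3) by (auto simp: vietoris_basic_def)
  then show ?thesis
    using assms by (simp add: openin_hyperspace_iff openin_vietoris_basic)
qed

lemma openin_hyperspace_meeting: "openin T U \<Longrightarrow> openin (hyperspace T) (compacts_meeting T U)"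
  by (simp add: openin_hyperspace_iff openin_vietoris_meeting) (simp add: compacts_meeting_def)

lemma hyperspace_basic_neighbourhood:
  assumes "openin (hyperspace T) \<U>" "K \<in> \<U>"
  obtains U \<V> where "openin T U" "finite \<V>" "\<V> \<noteq> {}" "\<forall>V\<in>\<V>. openin T V"
    "K \<in> vietoris_basic T U \<V>" "vietoris_basic T U \<V> \<subseteq> \<U>"
proof -
  have "openin (vietoris T) \<U>"
    using assms(1) by (simp add: openin_hyperspace_iff)
  from this assms(2) obtain U \<V> where U: "openin T U" "finite \<V>" "\<forall>V\<in>\<V>. openin T V"
    "K \<in> vietoris_basic T U \<V>" "vietoris_basic T U \<V> \<subseteq> \<U>"
    by (rule vietoris_basic_neighbourhood)
  have "K \<noteq> {}"
    using assms by (auto simp: openin_hyperspace_iff)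
  then have "K \<in> vietoris_basic T U (insert U \<V>)"
    using U(4) by (auto simp: vietoris_basic_def compacts_within_def)
  moreover have "vietoris_basic T U (insert U \<V>) \<subseteq> \<U>"
    using U(5) by (auto simp: vietoris_basic_def)
  ultimately show thesis
    using U(1-3) by (intro that[of U "insert U \<V>"]) auto
qed

lemma hyperspace_insert_neighbourhood:
  assumes "openin (hyperspace T) \<U>" "K \<in> \<U>" "x \<in> K"
  obtains U where "openin T U" "x \<in> U" "\<forall>y\<in>U. insert y K \<in> \<U>"
proof -
  obtain U \<V> where U: "openin T U" "K \<in> vietoris_basic T U \<V>" "vietoris_basic T U \<V> \<subseteq> \<U>"
    by (rule hyperspace_basic_neighbourhood[OF assms(1,2)])
  have "insert y K \<in> vietoris_basic T U \<V>" if "y \<in> U" for y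
  proof -
    have "y \<in> topspace T"
      using that openin_subset[OF U(1)] by blast
    then have "compactin T (insert y K)"
      using U(2) compactin_Un[of T "{y}" K] by (simp add: vietoris_basic_def compacts_within_def)
    then show ?thesis
      using that U(2) by (auto simp: vietoris_basic_def compacts_within_def)
  qed
  moreover have "x \<in> U"
    using assms(3) U(2) by (auto simp: vietoris_basic_def compacts_within_def)
  ultimately show thesis
    using U(1,3) by (intro that[of U]) auto
qed

lemma Hausdorff_space_hyperspace: "Hausdorff_space T \<Longrightarrow> Hausdorff_space (hyperspace T)"
  unfolding hyperspace_def by (intro Hausdorff_space_subtopology Hausdorff_space_vietoris)

lemma compact_space_hyperspace:
  assumes "compact_space T"
  shows "compact_space (hyperspace T)"
proof -
  have "compacts_within T {} = {{}}"
    by (auto simp: compacts_within_def)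
  then have "openin (vietoris T) {{}}"
    by (metis openin_empty openin_vietoris_within)
  then have "closedin (vietoris T) (topspace (vietoris T) - {{}})"
    by (intro closedin_diff closedin_topspace)
  then show ?thesis
    unfolding hyperspace_def
    by (intro compact_space_subtopology closedin_compact_space compact_space_vietoris assms)
qed

lemma comeager_in_hyperspace_meets_open:
  assumes "compact_space T" "Hausdorff_space T"
    and "comeager_in (hyperspace T) F" "openin (hyperspace T) \<U>" "\<U> \<noteq> {}"
  shows "\<U> \<inter> F \<noteq> {}"
proof -
  have "compact_space (hyperspace T)" "Hausdorff_space (hyperspace T)"
    by (intro compact_space_hyperspace Hausdorff_space_hyperspace assms)+
  then have "locally_compact_space (hyperspace T) \<and> regular_space (hyperspace T)"
    by (simp add: compact_imp_locally_compact_space compact_Hausdorff_imp_regular_space)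
  then show ?thesis
    by (rule comeager_in_meets_open[OF disjI2 assms(3-5)])
qed

lemma closedin_hyperspace_membership:
  assumes "Hausdorff_space T"
  shows "closedin (prod_topology (hyperspace T) T) {(K, x). K \<in> topspace (hyperspace T) \<and> x \<in> K}"
proof -
  let ?N = "topspace (vietoris T) - {{}}"
  have "{(K, x). K \<in> topspace (hyperspace T) \<and> x \<in> K}
      = {(K, x). compactin T K \<and> x \<in> K} \<inter> (?N \<times> topspace T)"
    using compactin_subset_topspace by fastforce
  then show ?thesis
    unfolding hyperspace_def[of T] prod_topology_subtopology(1) closedin_subtopology
    using closedin_vietoris_membership[OF assms] by blast
qed

lemma uncountable_hyperspace_containing:
  assumes "uncountable (topspace T)" "x \<in> topspace T"
  shows "uncountable {K \<in> topspace (hyperspace T). x \<in> K}"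
proof
  assume "countable {K \<in> topspace (hyperspace T). x \<in> K}"
  moreover have "(\<lambda>y. {x, y}) ` topspace T \<subseteq> {K \<in> topspace (hyperspace T). x \<in> K}"
    using assms(2) by (auto intro: finite_imp_compactin)
  ultimately have "countable ((\<lambda>y. {x, y}) ` topspace T)"
    by (rule countable_subset[rotated])
  moreover have "inj_on (\<lambda>y. {x, y}) (topspace T)"
    by (auto simp: inj_on_def doubleton_eq_iff)
  ultimately show False
    using assms(1) countable_image_inj_on by blast
qed

section \<open>Generic compact sets\<close>

lemma nowhere_dense_in_hyperspace_meeting:
  assumes "nowhere_dense_in T N"
  shows "nowhere_dense_in (hyperspace T) (compacts_meeting T N)"
  unfolding nowhere_dense_in_iff_open_disjoint
proof (intro conjI allI impI; (elim conjE)?)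
  show "compacts_meeting T N \<subseteq> topspace (hyperspace T)"
    by (auto simp: compacts_meeting_def)
  fix \<U> assume "openin (hyperspace T) \<U>" "\<U> \<noteq> {}"
  then obtain K U \<V> where U: "openin T U" "finite \<V>" "\<V> \<noteq> {}" "\<forall>V\<in>\<V>. openin T V"
    and K: "K \<in> vietoris_basic T U \<V>" and \<U>: "vietoris_basic T U \<V> \<subseteq> \<U>"
    using hyperspace_basic_neighbourhood by (metis all_not_in_conv)
  let ?U = "U - T closure_of N"
  have "openin T ?U"
    using U(1) by (simp add: openin_diff)
  have "?U \<inter> V \<noteq> {}" if "V \<in> \<V>" for V
  proof
    assume "?U \<inter> V = {}"
    moreover have "openin T (U \<inter> V)"
      using U that by blast
    ultimately have "U \<inter> V \<subseteq> T interior_of (T closure_of N)"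
      by (intro interior_of_maximal) blast+
    moreover have "U \<inter> V \<noteq> {}"
      using K that by (auto simp: vietoris_basic_def compacts_within_def)
    ultimately show False
      using assms by (simp add: nowhere_dense_in_def)
  qed
  then have "vietoris_basic T ?U \<V> \<noteq> {}"
    by (intro vietoris_basic_nonempty \<open>openin T ?U\<close> U(2))
  moreover have "openin (hyperspace T) (vietoris_basic T ?U \<V>)"
    using U \<open>openin T ?U\<close> by (simp add: openin_hyperspace_basic)
  moreover have "vietoris_basic T ?U \<V> \<subseteq> \<U>"
    using \<U> by (auto simp: vietoris_basic_def compacts_within_def)
  moreover have "N \<subseteq> T closure_of N"
    using assms by (simp add: closure_of_subset nowhere_dense_in_def)
  then have "vietoris_basic T ?U \<V> \<inter> compacts_meeting T N = {}"
    by (auto simp: vietoris_basic_def compacts_within_def compacts_meeting_def)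
  ultimately show "\<exists>\<W>. openin (hyperspace T) \<W> \<and> \<W> \<noteq> {} \<and> \<W> \<subseteq> \<U> \<and> \<W> \<inter> compacts_meeting T N = {}"
    by blast
qed

lemma comeager_in_hyperspace_disjoint_meager:
  assumes "meager_in T M"
  shows "comeager_in (hyperspace T) {K \<in> topspace (hyperspace T). K \<inter> M = {}}"
proof -
  obtain \<N> where \<N>: "countable \<N>" "\<And>N. N \<in> \<N> \<Longrightarrow> nowhere_dense_in T N" "M \<subseteq> \<Union>\<N>"
    using assms unfolding meager_in_iff_countable_cover by blast
  then have "meager_in (hyperspace T) (\<Union>N\<in>\<N>. compacts_meeting T N)"
    by (intro meager_in_UN nowhere_dense_imp_meager_in nowhere_dense_in_hyperspace_meeting)
  moreover have "topspace (hyperspace T) - {K \<in> topspace (hyperspace T). K \<inter> M = {}}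
      \<subseteq> (\<Union>N\<in>\<N>. compacts_meeting T N)"
    using \<N>(3) by (auto simp: compacts_meeting_def)
  ultimately show ?thesis
    unfolding comeager_in_def by (auto intro: meager_in_subset)
qed

definition perfect_in :: "'a topology \<Rightarrow> 'a set \<Rightarrow> bool" where
  "perfect_in T S \<longleftrightarrow> T derived_set_of S = S"

lemma perfect_in_separated_points:
  assumes "Hausdorff_space T" "perfect_in T S" "openin T U" "x \<in> S" "x \<in> U"
  obtains y P Q where "y \<in> S" "openin T P" "openin T Q" "x \<in> P" "y \<in> Q" "P \<subseteq> U" "Q \<subseteq> U" "disjnt P Q"
proof -
  have "x \<in> T derived_set_of S"
    using assms(2,4) by (simp add: perfect_in_def)
  then obtain y where y: "y \<noteq> x" "y \<in> S" "y \<in> U"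
    using assms(3,5) unfolding in_derived_set_of by blast
  moreover have "x \<in> topspace T" "y \<in> topspace T"
    using assms(5) y(3) openin_subset[OF assms(3)] by auto
  ultimately obtain P Q where "openin T P" "openin T Q" "x \<in> P" "y \<in> Q" "disjnt P Q"
    using assms(1) unfolding Hausdorff_space_def by metis
  then show thesis
    using y assms(3,5) by (intro that[of y "P \<inter> U" "Q \<inter> U"]) (auto simp: disjnt_iff)
qed

lemma nowhere_dense_in_hyperspace_singleton_trace:
  assumes "Hausdorff_space T" "perfect_in T (topspace T)" "openin T V"
  shows "nowhere_dense_in (hyperspace T) {K \<in> topspace (hyperspace T). is_singleton (K \<inter> V)}"
    (is "nowhere_dense_in _ ?E")
  unfolding nowhere_dense_in_iff_open_disjoint
proof (intro conjI allI impI; (elim conjE)?)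
  fix \<U> assume \<U>: "openin (hyperspace T) \<U>" "\<U> \<noteq> {}"
  show "\<exists>\<W>. openin (hyperspace T) \<W> \<and> \<W> \<noteq> {} \<and> \<W> \<subseteq> \<U> \<and> \<W> \<inter> ?E = {}"
  proof (cases "\<U> \<inter> ?E = {}")
    case True
    then show ?thesis
      using \<U> by blast
  next
    case False
    then obtain K x where K: "K \<in> \<U>" "x \<in> K" "x \<in> V"
      by (auto simp: is_singleton_def)
    obtain U where U: "openin T U" "x \<in> U" "\<forall>y\<in>U. insert y K \<in> \<U>"
      by (rule hyperspace_insert_neighbourhood[OF \<U>(1) K(1,2)])
    have "openin T (U \<inter> V)" "x \<in> topspace T" "x \<in> U \<inter> V"
      using U(1,2) K(3) assms(3) openin_subset[OF assms(3)] by auto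
    then obtain y P Q where PQ: "openin T P" "openin T Q"
      "x \<in> P" "y \<in> Q" "P \<subseteq> U \<inter> V" "Q \<subseteq> U \<inter> V" "disjnt P Q"
      by (rule perfect_in_separated_points[OF assms(1,2)])
    let ?\<W> = "\<U> \<inter> compacts_meeting T P \<inter> compacts_meeting T Q"
    have "openin (hyperspace T) ?\<W>"
      by (intro openin_Int \<U>(1) openin_hyperspace_meeting PQ(1,2))
    moreover have "insert y K \<in> \<U>"
      using U(3) PQ(4,6) by blast
    then have "insert y K \<in> ?\<W>"
      using openin_subset[OF \<U>(1)] K(2) PQ(3,4) by (auto simp: compacts_meeting_def)
    moreover have "\<not> is_singleton (L \<inter> V)" if L: "L \<in> ?\<W>" for L
    proof -
      obtain p q where "p \<in> L \<inter> P" "q \<in> L \<inter> Q"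
        using L by (auto simp: compacts_meeting_def)
      then have "p \<in> L \<inter> V" "q \<in> L \<inter> V" "p \<noteq> q"
        using PQ(5-7) by (auto simp: disjnt_iff)
      then show ?thesis
        by (metis is_singletonE singletonD)
    qed
    ultimately show ?thesis
      by (intro exI[of _ ?\<W>]) blast
  qed
qed blast

lemma second_countableE:
  assumes "second_countable T"
  obtains \<B> where "countable \<B>" "\<And>V. V \<in> \<B> \<Longrightarrow> openin T V"
    "\<And>U x. openin T U \<Longrightarrow> x \<in> U \<Longrightarrow> \<exists>V\<in>\<B>. x \<in> V \<and> V \<subseteq> U"
  using assms unfolding second_countable_def by metis

lemma comeager_in_hyperspace_perfect:
  assumes "Hausdorff_space T" "second_countable T" "perfect_in T (topspace T)"
  shows "comeager_in (hyperspace T) {K \<in> topspace (hyperspace T). perfect_in T K}"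
proof -
  obtain \<B> where \<B>: "countable \<B>" "\<And>V. V \<in> \<B> \<Longrightarrow> openin T V"
    "\<And>U x. openin T U \<Longrightarrow> x \<in> U \<Longrightarrow> \<exists>V\<in>\<B>. x \<in> V \<and> V \<subseteq> U"
    using second_countableE[OF assms(2)] by metis
  let ?E = "\<lambda>V. {K \<in> topspace (hyperspace T). is_singleton (K \<inter> V)}"
  have "meager_in (hyperspace T) (\<Union>V\<in>\<B>. ?E V)"
    using assms \<B>(1,2)
    by (intro meager_in_UN nowhere_dense_imp_meager_in nowhere_dense_in_hyperspace_singleton_trace)
  moreover have "K \<in> (\<Union>V\<in>\<B>. ?E V)"
    if K: "K \<in> topspace (hyperspace T)" "\<not> perfect_in T K" for K
  proof -
    have "closedin T K"
      using K(1) assms(1) by (auto intro: compactin_imp_closedin)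
    then obtain x where "x \<in> K" "x \<in> topspace T" "x \<notin> T derived_set_of K"
      using K(2) closedin_contains_derived_set[of T K] unfolding perfect_in_def by blast
    then obtain U where U: "x \<in> U" "openin T U" "K \<inter> U \<subseteq> {x}"
      unfolding in_derived_set_of by blast
    then obtain V where "V \<in> \<B>" "x \<in> V" "V \<subseteq> U"
      using \<B>(3) by blast
    then have "K \<inter> V = {x}"
      using \<open>x \<in> K\<close> U(3) by blast
    then show ?thesis
      using K(1) \<open>V \<in> \<B>\<close> by (auto simp: is_singleton_def)
  qed
  then have "topspace (hyperspace T) - {K \<in> topspace (hyperspace T). perfect_in T K} \<subseteq> (\<Union>V\<in>\<B>. ?E V)"
    by blast
  ultimately show ?thesis
    unfolding comeager_in_def by (auto elim: meager_in_subset)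
qed

lemma perfect_in_imp_uncountable:
  assumes "completely_metrizable_space T \<or> locally_compact_space T \<and> Hausdorff_space T"
    and "perfect_in T S" "S \<noteq> {}"
  shows "uncountable S"
  using lepoll_perfect_set[OF assms(1) _ assms(3)] assms(2) countable_lepoll uncountable_UNIV_real
  unfolding perfect_in_def by blast

lemma comeager_in_hyperspace_uncountable:
  assumes "locally_compact_space T" "Hausdorff_space T" "second_countable T"
    and "perfect_in T (topspace T)"
  shows "comeager_in (hyperspace T) {K \<in> topspace (hyperspace T). uncountable K}"
proof (rule comeager_in_superset)
  show "comeager_in (hyperspace T) {K \<in> topspace (hyperspace T). perfect_in T K}"
    by (intro comeager_in_hyperspace_perfect assms)
  show "{K \<in> topspace (hyperspace T). perfect_in T K} \<subseteq> {K \<in> topspace (hyperspace T). uncountable K}"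
    using assms(1,2) perfect_in_imp_uncountable[of T] by auto
qed blast

section \<open>Selectors\<close>

lemma comeager_in_hyperspace_contains_subset:
  assumes T: "compact_space T" "Hausdorff_space T"
    and F: "comeager_in (hyperspace T) F"
    and B: "baire_property_in T B" "\<not> meager_in T B"
  obtains K where "K \<in> F" "K \<subseteq> B"
proof -
  obtain W where W: "openin T W" "meager_in T (sym_diff B W)"
    using B(1) unfolding baire_property_in_def by blast
  have "W \<noteq> {}"
    using B(2) W(2) by auto
  then have "vietoris_basic T W {W} \<noteq> {}"
    by (intro vietoris_basic_nonempty W(1)) auto
  moreover have "openin (hyperspace T) (vietoris_basic T W {W})"
    by (intro openin_hyperspace_basic W(1)) (auto simp: W(1))
  moreover have "meager_in T (W - B)"
    by (rule meager_in_subset[OF W(2)]) blast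
  then have "comeager_in (hyperspace T) ({K \<in> topspace (hyperspace T). K \<inter> (W - B) = {}} \<inter> F)"
    by (intro comeager_in_Int comeager_in_hyperspace_disjoint_meager F)
  ultimately obtain K where "K \<in> F" "K \<in> vietoris_basic T W {W}" "K \<inter> (W - B) = {}"
    using comeager_in_hyperspace_meets_open[OF T] by blast
  then show thesis
    by (intro that[of K]) (auto simp: vietoris_basic_def compacts_within_def)
qed

lemma meager_in_selected_outside_open:
  assumes T: "compact_space T" "Hausdorff_space T" and F: "comeager_in (hyperspace T) F"
    and selector: "\<And>K. K \<in> F \<Longrightarrow> f K \<in> K"
    and left_inverse: "\<And>K. K \<in> F \<Longrightarrow> g (f K) = K"
    and V: "openin T V" "baire_property_in T {x \<in> G. g x \<inter> V \<noteq> {}}"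
  shows "meager_in T {x \<in> G. x \<notin> V \<and> g x \<inter> V \<noteq> {}}" (is "meager_in T ?B")
proof (rule ccontr)
  assume "\<not> meager_in T ?B"
  have "?B = {x \<in> G. g x \<inter> V \<noteq> {}} - V"
    by blast
  then have "baire_property_in T ?B"
    using V by (simp add: baire_property_in_diff baire_property_in_open)
  then obtain K where K: "K \<in> F" "K \<subseteq> ?B"
    using comeager_in_hyperspace_contains_subset[OF T F] \<open>\<not> meager_in T ?B\<close> by blast
  then have "f K \<in> ?B"
    using selector by blast
  then have "K \<inter> V \<noteq> {}"
    using left_inverse[OF K(1)] by simp
  then show False
    using K(2) by blast
qed

lemma no_selector_with_baire_measurable_left_inverse:
  assumes T: "compact_space T" "Hausdorff_space T" "second_countable T"
    and nonempty: "topspace T \<noteq> {}" and perfect: "perfect_in T (topspace T)"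
    and F: "comeager_in (hyperspace T) F"
    and selector: "\<And>K. K \<in> F \<Longrightarrow> f K \<in> K \<inter> G"
    and left_inverse: "\<And>K. K \<in> F \<Longrightarrow> g (f K) = K"
    and baire_measurable: "\<And>V. openin T V \<Longrightarrow> baire_property_in T {x \<in> G. g x \<inter> V \<noteq> {}}"
  shows False
proof -
  define B where "B V = {x \<in> G. x \<notin> V \<and> g x \<inter> V \<noteq> {}}" for V
  have meager_B: "meager_in T (B V)" if "openin T V" for V
    unfolding B_def using selector left_inverse that
    by (intro meager_in_selected_outside_open[OF T(1,2) F] baire_measurable) auto
  obtain \<B> where \<B>: "countable \<B>" "\<And>V. V \<in> \<B> \<Longrightarrow> openin T V"
    "\<And>U x. openin T U \<Longrightarrow> x \<in> U \<Longrightarrow> \<exists>V\<in>\<B>. x \<in> V \<and> V \<subseteq> U"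
    using second_countableE[OF T(3)] by metis
  have "meager_in T (\<Union>V\<in>\<B>. B V)"
    by (intro meager_in_UN \<B>(1) meager_B \<B>(2))
  then have "comeager_in (hyperspace T) ({K \<in> topspace (hyperspace T). K \<inter> (\<Union>V\<in>\<B>. B V) = {}}
      \<inter> ({K \<in> topspace (hyperspace T). perfect_in T K} \<inter> F))" (is "comeager_in _ ?generic")
    by (intro comeager_in_Int comeager_in_hyperspace_disjoint_meager comeager_in_hyperspace_perfect
        T(2,3) perfect F)
  then have "topspace (hyperspace T) \<inter> ?generic \<noteq> {}"
    using topspace_hyperspace_nonempty[OF nonempty]
    by (rule comeager_in_hyperspace_meets_open[OF T(1,2) _ openin_topspace])
  then obtain K where K: "K \<in> F" "perfect_in T K" "K \<inter> (\<Union>V\<in>\<B>. B V) = {}"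
    by blast
  have "f K \<in> K"
    using selector[OF K(1)] by blast
  moreover have "f K \<in> topspace T"
    using K(2) \<open>f K \<in> K\<close> derived_set_of_subset_topspace[of T K] by (auto simp: perfect_in_def)
  ultimately obtain y P Q where "y \<in> K" "openin T Q" "f K \<in> P" "y \<in> Q" "disjnt P Q"
    by (rule perfect_in_separated_points[OF T(2) K(2) openin_topspace])
  then obtain V where "V \<in> \<B>" "y \<in> V" "f K \<notin> V"
    using \<B>(3) by (metis disjnt_iff subsetD)
  then have "f K \<in> B V"
    using \<open>y \<in> K\<close> selector[OF K(1)] left_inverse[OF K(1)] by (auto simp: B_def)
  then show False
    using K(3) \<open>f K \<in> K\<close> \<open>V \<in> \<B>\<close> by blast
qed

lemma borel_isomorphism_not_selector:
  assumes T: "compact_space T" "Hausdorff_space T" "second_countable T"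
      "topspace T \<noteq> {}" "perfect_in T (topspace T)"
    and F: "comeager_in (hyperspace T) F" and G: "baire_property_in T G"
    and f: "borel_isomorphism (subtopology (hyperspace T) F) (subtopology T G) f"
  shows "\<exists>K\<in>F. f K \<notin> K"
proof (rule ccontr)
  assume selector: "\<not> (\<exists>K\<in>F. f K \<notin> K)"
  define g where "g = the_inv_into F f"
  have F_subset: "F \<subseteq> topspace (hyperspace T)"
    using F unfolding comeager_in_def by blast
  then have "topspace (subtopology (hyperspace T) F) = F" "topspace (subtopology T G) = G"
    using G unfolding baire_property_in_def by auto
  then have bij: "bij_betw f F G"
    and g: "g \<in> measurable (borel_of (subtopology T G)) (borel_of (subtopology (hyperspace T) F))"
    using f unfolding borel_isomorphism_def g_def by simp_all
  have g_in_F: "g x \<in> F" if "x \<in> G" for x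
    using bij_betw_the_inv_into[OF bij] that unfolding g_def by (rule bij_betwE[rule_format])
  show False
  proof (rule no_selector_with_baire_measurable_left_inverse[OF T F])
    show "f K \<in> K \<inter> G" if "K \<in> F" for K
      using selector bij that by (auto simp: bij_betw_def)
    show "g (f K) = K" if "K \<in> F" for K
      using bij that by (simp add: g_def bij_betw_def the_inv_into_f_f)
    show "baire_property_in T {x \<in> G. g x \<inter> V \<noteq> {}}" if "openin T V" for V
    proof -
      have "openin (subtopology (hyperspace T) F) (F \<inter> compacts_meeting T V)"
        using that by (intro openin_subtopology_Int2 openin_hyperspace_meeting)
      then have "baire_property_in T {x \<in> G. g x \<in> F \<inter> compacts_meeting T V}"
        by (rule baire_property_in_borel_vimage_open[OF G g])
      moreover have "{x \<in> G. g x \<in> F \<inter> compacts_meeting T V} = {x \<in> G. g x \<inter> V \<noteq> {}}"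
        using g_in_F F_subset by (auto simp: compacts_meeting_def)
      ultimately show ?thesis
        by simp
    qed
  qed
qed

section \<open>Product spaces and the Cantor space\<close>

lemma product_topology_base_neighbourhood:
  assumes base: "\<And>i U x. i \<in> I \<Longrightarrow> openin (X i) U \<Longrightarrow> x \<in> U \<Longrightarrow> \<exists>V\<in>\<B> i. x \<in> V \<and> V \<subseteq> U"
    and U: "openin (product_topology X I) U" "x \<in> U"
  obtains J V where "finite J" "J \<subseteq> I" "V \<in> (\<Pi>\<^sub>E i\<in>J. \<B> i)"
    "x \<in> (\<Pi>\<^sub>E i\<in>I. if i \<in> J then V i else topspace (X i))"
    "(\<Pi>\<^sub>E i\<in>I. if i \<in> J then V i else topspace (X i)) \<subseteq> U"
proof -
  obtain S where S: "x \<in> (\<Pi>\<^sub>E i\<in>I. S i)" "\<And>i. openin (X i) (S i)" "finite {i. S i \<noteq> topspace (X i)}"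
    "(\<Pi>\<^sub>E i\<in>I. S i) \<subseteq> U"
    using product_topology_open_contains_basis[OF U] by blast
  define J where "J = {i \<in> I. S i \<noteq> topspace (X i)}"
  have "\<exists>V\<in>\<B> i. x i \<in> V \<and> V \<subseteq> S i" if "i \<in> J" for i
    using that S(1,2) by (intro base) (auto simp: J_def)
  then obtain V where V: "\<And>i. i \<in> J \<Longrightarrow> V i \<in> \<B> i \<and> x i \<in> V i \<and> V i \<subseteq> S i"
    by metis
  have "(\<Pi>\<^sub>E i\<in>I. if i \<in> J then restrict V J i else topspace (X i)) \<subseteq> (\<Pi>\<^sub>E i\<in>I. S i)"
    by (rule PiE_mono) (use V in \<open>auto simp: J_def\<close>)
  then show thesis
    using S(1,3,4) V by (intro that[of J "restrict V J"]) (auto simp: J_def PiE_iff)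
qed

lemma second_countable_product_topology:
  assumes "countable I" "\<And>i. i \<in> I \<Longrightarrow> second_countable (X i)"
  shows "second_countable (product_topology X I)"
proof -
  obtain \<B> where \<B>: "\<And>i. i \<in> I \<Longrightarrow> countable (\<B> i)" "\<And>i V. i \<in> I \<Longrightarrow> V \<in> \<B> i \<Longrightarrow> openin (X i) V"
    "\<And>i U x. i \<in> I \<Longrightarrow> openin (X i) U \<Longrightarrow> x \<in> U \<Longrightarrow> \<exists>V\<in>\<B> i. x \<in> V \<and> V \<subseteq> U"
    using assms(2) unfolding second_countable_def by metis
  let ?box = "\<lambda>J V. \<Pi>\<^sub>E i\<in>I. if i \<in> J then V i else topspace (X i)"
  let ?base = "\<Union>J\<in>{J. finite J \<and> J \<subseteq> I}. ?box J ` (\<Pi>\<^sub>E i\<in>J. \<B> i)"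
  show ?thesis
    unfolding second_countable_def
  proof (intro exI[of _ ?base] conjI ballI allI impI; (elim conjE)?)
    show "countable ?base"
      using assms(1) \<B>(1)
      by (intro countable_UN countable_Collect_finite_subset countable_image countable_PiE) auto
    show "openin (product_topology X I) W" if "W \<in> ?base" for W
    proof -
      from that obtain J V where J: "finite J" "J \<subseteq> I" "V \<in> (\<Pi>\<^sub>E i\<in>J. \<B> i)" and W: "W = ?box J V"
        by blast
      show ?thesis
        unfolding W openin_PiE_gen using J \<B>(2) by (intro disjI2 conjI) (auto elim: rev_finite_subset)
    qed
    show "\<exists>W\<in>?base. x \<in> W \<and> W \<subseteq> U" if U: "openin (product_topology X I) U" "x \<in> U" for U x
    proof -
      obtain J V where "finite J" "J \<subseteq> I" "V \<in> (\<Pi>\<^sub>E i\<in>J. \<B> i)" "x \<in> ?box J V" "?box J V \<subseteq> U"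
        by (rule product_topology_base_neighbourhood[OF \<B>(3) U])
      then show ?thesis
        by blast
    qed
  qed
qed

lemma perfect_in_product_topology:
  assumes "infinite I" "\<And>i x. i \<in> I \<Longrightarrow> topspace (X i) \<noteq> {x}"
  shows "perfect_in (product_topology X I) (topspace (product_topology X I))"
proof -
  have "\<not> openin (product_topology X I) {x}" if "x \<in> topspace (product_topology X I)" for x
  proof -
    have "{i \<in> I. {x i} \<noteq> topspace (X i)} = I"
      using assms(2) by blast
    moreover have "(\<Pi>\<^sub>E i\<in>I. {x i}) = {x}"
      using that by (intro PiE_singleton) (auto simp: PiE_iff)
    ultimately show ?thesis
      using openin_PiE_gen[of X I "\<lambda>i. {x i}"] assms(1) by simp
  qed
  then show ?thesis
    unfolding perfect_in_def derived_set_of_topspace by blast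
qed

lemma compact_space_cantor: "compact_space cantor_space"
  unfolding cantor_space_eq
  by (simp add: compact_space_product_topology compact_space_discrete_topology)

lemma Hausdorff_space_cantor: "Hausdorff_space cantor_space"
  unfolding cantor_space_eq by (simp add: Hausdorff_space_product_topology)

lemma second_countable_cantor: "second_countable cantor_space"
  unfolding cantor_space_eq
  by (intro second_countable_product_topology) (simp_all add: second_countable_discrete_topology)

lemma perfect_in_cantor: "perfect_in cantor_space (topspace cantor_space)"
  unfolding cantor_space_eq by (intro perfect_in_product_topology) (simp_all add: UNIV_bool)

lemma uncountable_cantor: "uncountable (UNIV :: (nat \<Rightarrow> bool) set)"
  using perfect_in_imp_uncountable[OF _ perfect_in_cantor]
  by (simp add: compact_space_cantor Hausdorff_space_cantor compact_imp_locally_compact_space)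

theorem theorem1p4:
  fixes X :: "(nat \<Rightarrow> bool) set topology"
    and Y :: "(nat \<Rightarrow> bool) topology"
    and A :: "((nat \<Rightarrow> bool) set \<times> (nat \<Rightarrow> bool)) set"
  assumes X: "X = subtopology (vietoris cantor_space) (topspace (vietoris cantor_space) - {{}})"
    and Y: "Y = cantor_space"
    and A: "A = {(K, x). K \<in> topspace X \<and> x \<in> topspace Y \<and> x \<in> K}"
  shows "closedin (prod_topology X Y) A
    \<and> (\<forall>x \<in> topspace Y. {K. (K, x) \<in> A} = {K \<in> topspace X. x \<in> K}
          \<and> uncountable {K \<in> topspace X. x \<in> K})
    \<and> (\<forall>K \<in> topspace X. {x. (K, x) \<in> A} = K)
    \<and> (\<exists>C. comeager_in X C \<and> (\<forall>K \<in> C. uncountable {x. (K, x) \<in> A}))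
    \<and> (\<forall>F G. F \<in> sets (borel_of X) \<and> comeager_in X F
          \<and> G \<in> sets (borel_of Y) \<and> comeager_in Y G
          \<longrightarrow> \<not> (\<exists>f. borel_isomorphism (subtopology X F) (subtopology Y G) f
                 \<and> (\<forall>K \<in> F. (K, f K) \<in> A)))"
proof -
  have X_eq: "X = hyperspace cantor_space"
    by (simp only: X hyperspace_def)
  have A_eq: "A = {(K, x). K \<in> topspace X \<and> x \<in> K}"
    by (simp add: A Y)
  have closed: "closedin (prod_topology X Y) A"
    unfolding A_eq X_eq Y by (rule closedin_hyperspace_membership[OF Hausdorff_space_cantor])
  have uncountable_horizontal: "uncountable {K \<in> topspace X. x \<in> K}" for x
    unfolding X_eq by (intro uncountable_hyperspace_containing) (simp_all add: uncountable_cantor)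
  have comeager_uncountable: "comeager_in X {K \<in> topspace X. uncountable K}"
    unfolding X_eq by (intro comeager_in_hyperspace_uncountable compact_imp_locally_compact_space
        compact_space_cantor Hausdorff_space_cantor second_countable_cantor perfect_in_cantor)
  have no_isomorphism: False
    if "comeager_in X F" "comeager_in Y G" "borel_isomorphism (subtopology X F) (subtopology Y G) f"
      "\<forall>K\<in>F. (K, f K) \<in> A" for F G f
    using that borel_isomorphism_not_selector[OF compact_space_cantor Hausdorff_space_cantor
        second_countable_cantor _ perfect_in_cantor, of F G f]
    by (auto simp: A_eq X_eq Y baire_property_in_comeager)
  have "{K. (K, x) \<in> A} = {K \<in> topspace X. x \<in> K}" "K \<in> topspace X \<Longrightarrow> {x. (K, x) \<in> A} = K" for x K
    by (simp_all add: A_eq)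
  then show ?thesis
    using closed uncountable_horizontal comeager_uncountable
    by (intro conjI exI[of _ "{K \<in> topspace X. uncountable K}"]) (auto dest: no_isomorphism)
qed

end
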